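(* Let $M$, $P$, $K$ be real symmetric positive semidefinite $m\times m$ matrices, and assume that $M$ is invertible. Let $F$ be a real $m\times k$ matrix and $u\in C([0,\infty);\mathbb R^k)$. Then the following holds. (1) The linear system $\Sigma_i$ associated to $$x'(t)=\begin{bmatrix}0&K^{1/2}M^{-1/2}\\ -M^{-1/2}K^{1/2}&-M^{-1/2}PM^{-1/2}\end{bmatrix}x(t)+\begin{bmatrix}0\\ M^{-1/2}F\end{bmatrix}u(t),\qquad y(t)=\begin{bmatrix}0&F^TM^{-1/2}\end{bmatrix}x(t),\qquad t\ge0,\qquad( * )$$ is impedance passive. (2) Let $\alpha\in\operatorname{range}(K)$ and $\beta\in\mathbb R^m$ be arbitrary. Then the function $x=\begin{bmatrix}x_1\\ x_2\end{bmatrix}\in C^1([0,\infty);\mathbb R^{2m})$ satisfies $( * )$ with $x(0)=\begin{bmatrix}\alpha\\ \beta\end{bmatrix}$ if and only if the function $z\in C^2([0,\infty);\mathbb R^m)$ given by $$z(t)=\int_0^tM^{-1/2}x_2(\tau)\,d\tau+\gamma,\qquad t\ge0,$$ satisfies $x_1(t)=K^{1/2}z(t)$ for $t\ge 0$ and $$Mz''(t)+Pz'(t)+Kz(t)=Fu(t),\qquad y(t)=F^Tz'(t),\quad t\ge0,\qquad z(0)=\gamma,\quad z'(0)=M^{-1/2}\beta,$$ for some (hence, for all) $\gamma\in\mathbb R^m$ satisfying $K^{1/2}\gamma=\alpha$.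
   Context: Norms and inner products are Euclidean. A linear system $x'(t)=Ax(t)+Bu(t)$, $y(t)=Cx(t)+Du(t)$ (real matrices, $u$ and $y$ of the same dimension) is impedance passive if all functions $u,x,y$ satisfying these equations satisfy $\frac{d}{dt}\|x(t)\|^2\le2\langle u(t),y(t)\rangle$ for all $t$ in the time interval. *)

theory Defs
  imports "HOL-Analysis.Analysis"
begin

definition sym_psd :: "real^'n^'n \<Rightarrow> bool" where
  "sym_psd A \<longleftrightarrow> transpose A = A \<and> (\<forall>v. 0 \<le> v \<bullet> (A *v v))"

text \<open>The principal square root, i.e. the unique symmetric positive semidefinite one.
  Only meaningful for symmetric positive semidefinite arguments.\<close>
definition mat_sqrt :: "real^'n^'n \<Rightarrow> real^'n^'n" where
  "mat_sqrt A = (THE S. sym_psd S \<and> S ** S = A)"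

definition mat_inv_sqrt :: "real^'n^'n \<Rightarrow> real^'n^'n" where
  "mat_inv_sqrt A = matrix_inv (mat_sqrt A)"

text \<open>Block objects are indexed by sum types. Since a matrix is a vector of rows,
  \<open>vstack\<close> serves both for vectors and for matrices (one block above the other).\<close>
definition vstack :: "'a^'m \<Rightarrow> 'a^'n \<Rightarrow> 'a^('m + 'n)" where
  "vstack v w = (\<chi> i. case i of Inl j \<Rightarrow> v $ j | Inr j \<Rightarrow> w $ j)"

definition hstack :: "'a^'m^'r \<Rightarrow> 'a^'n^'r \<Rightarrow> 'a^('m + 'n)^'r" where
  "hstack A B = (\<chi> i. vstack (A $ i) (B $ i))"

text \<open>Derivatives are taken within \<open>T\<close>, hence one-sided at an endpoint of an interval \<open>T\<close>.
  (The library's \<open>C1_differentiable_on\<close> uses two-sided derivatives at every point.)\<close>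
definition C1_on :: "real set \<Rightarrow> (real \<Rightarrow> 'a::real_normed_vector) \<Rightarrow> bool" where
  "C1_on T f \<longleftrightarrow>
     (\<exists>f'. (\<forall>t\<in>T. (f has_vector_derivative f' t) (at t within T)) \<and> continuous_on T f')"

definition C2_on :: "real set \<Rightarrow> (real \<Rightarrow> 'a::real_normed_vector) \<Rightarrow> bool" where
  "C2_on T f \<longleftrightarrow>
     (\<exists>f'. (\<forall>t\<in>T. (f has_vector_derivative f' t) (at t within T)) \<and> C1_on T f')"

definition deriv_on :: "real set \<Rightarrow> (real \<Rightarrow> 'a::real_normed_vector) \<Rightarrow> real \<Rightarrow> 'a" where
  "deriv_on T f t = vector_derivative f (at t within T)"

definition linear_system ::
  "real set \<Rightarrow> real^'n^'n \<Rightarrow> real^'k^'n \<Rightarrow> real^'n^'p \<Rightarrow> real^'k^'p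
    \<Rightarrow> (real \<Rightarrow> real^'k) \<Rightarrow> (real \<Rightarrow> real^'n) \<Rightarrow> (real \<Rightarrow> real^'p) \<Rightarrow> bool" where
  "linear_system T A B C D u x y \<longleftrightarrow>
     (\<forall>t\<in>T. (x has_vector_derivative (A *v x t + B *v u t)) (at t within T) \<and>
             y t = C *v x t + D *v u t)"

definition impedance_passive ::
  "real set \<Rightarrow> real^'n^'n \<Rightarrow> real^'k^'n \<Rightarrow> real^'n^'k \<Rightarrow> real^'k^'k \<Rightarrow> bool" where
  "impedance_passive T A B C D \<longleftrightarrow>
     (\<forall>u x y. linear_system T A B C D u x y \<longrightarrow>
        (\<forall>t\<in>T. \<exists>d. ((\<lambda>s. (norm (x s))\<^sup>2) has_real_derivative d) (at t within T) \<and>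
                    d \<le> 2 * (u t \<bullet> y t)))"

definition sys_A :: "real^'m^'m \<Rightarrow> real^'m^'m \<Rightarrow> real^'m^'m \<Rightarrow> real^('m + 'm)^('m + 'm)" where
  "sys_A M P K = vstack
     (hstack 0 (mat_sqrt K ** mat_inv_sqrt M))
     (hstack (- (mat_inv_sqrt M ** mat_sqrt K)) (- (mat_inv_sqrt M ** P ** mat_inv_sqrt M)))"

definition sys_B :: "real^'m^'m \<Rightarrow> real^'k^'m \<Rightarrow> real^'k^('m + 'm)" where
  "sys_B M F = vstack 0 (mat_inv_sqrt M ** F)"

definition sys_C :: "real^'m^'m \<Rightarrow> real^'k^'m \<Rightarrow> real^('m + 'm)^'k" where
  "sys_C M F = hstack 0 (transpose F ** mat_inv_sqrt M)"

definition position ::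
  "real^'m^'m \<Rightarrow> (real \<Rightarrow> real^'m) \<Rightarrow> real^'m \<Rightarrow> real \<Rightarrow> real^'m" where
  "position M x2 \<gamma> t = integral {0..t} (\<lambda>\<tau>. mat_inv_sqrt M *v x2 \<tau>) + \<gamma>"

definition second_order_system ::
  "real^'m^'m \<Rightarrow> real^'m^'m \<Rightarrow> real^'m^'m \<Rightarrow> real^'k^'m
    \<Rightarrow> (real \<Rightarrow> real^'k) \<Rightarrow> (real \<Rightarrow> real^'m) \<Rightarrow> (real \<Rightarrow> real^'k) \<Rightarrow> bool" where
  "second_order_system M P K F u z y \<longleftrightarrow>
     (\<forall>t\<ge>0. M *v deriv_on {0..} (deriv_on {0..} z) t + P *v deriv_on {0..} z t + K *v z t
               = F *v u t \<and>
             y t = transpose F *v deriv_on {0..} z t)"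

end

theory Submission
  imports Defs
begin

text \<open>
  Write \<open>R = K\<^sup>1\<^sup>/\<^sup>2\<close> and \<open>N = M\<^sup>-\<^sup>1\<^sup>/\<^sup>2\<close>. Two algebraic facts carry everything: \<open>R\<close> and \<open>N\<close> are
  symmetric, and \<open>R R = K\<close>, \<open>N\<^sup>-\<^sup>1 N\<^sup>-\<^sup>1 = M\<close>.

  Passivity is an energy balance. Along a trajectory the derivative of \<open>\<parallel>x\<parallel>\<^sup>2\<close> is \<open>2 \<langle>x, x'\<rangle>\<close>; by
  symmetry of \<open>R\<close> and \<open>N\<close> the off-diagonal blocks of the system matrix are skew and cancel, the
  diagonal block contributes \<open>-2 \<langle>N x\<^sub>2, P N x\<^sub>2\<rangle> \<le> 0\<close>, and what remains is the supplied power
  \<open>2 \<langle>u, F\<^sup>T N x\<^sub>2\<rangle> = 2 \<langle>u, y\<rangle>\<close> (\<open>sys_impedance_passive\<close>).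

  For the equivalence, the position satisfies \<open>z' = N x\<^sub>2\<close> and \<open>z'' = N x\<^sub>2'\<close>. The first block row
  \<open>x\<^sub>1' = R N x\<^sub>2\<close> says that \<open>x\<^sub>1 - R z\<close> has derivative zero, which, given \<open>x\<^sub>1(0) = R \<gamma>\<close>, means
  \<open>x\<^sub>1 = R z\<close>. After this substitution the second block row is \<open>N\<close> applied to the second-order
  equation, and \<open>N\<close> is invertible (\<open>second_order_iff_momentum_balance\<close>). This works for each
  fixed \<open>\<gamma>\<close> with \<open>R \<gamma> = \<alpha>\<close> separately (\<open>first_order_iff_second_order\<close>). Since the first-order
  side does not mention \<open>\<gamma>\<close>, ``some'' and ``all'' then agree as soon as one such \<open>\<gamma>\<close> exists, and
  \<open>\<alpha> = K \<delta> = R (R \<delta>)\<close> provides it.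

  As principal square roots are defined by a definite description, their existence and uniqueness
  have to be established first. Both follow from an orthonormal eigenbasis of a symmetric
  operator (\<open>orthonormal_eigenbasis\<close>).
\<close>

section \<open>The spectral theorem in Euclidean space\<close>

text \<open>
  Where a nonnegative quadratic form vanishes it is minimal, so its gradient \<open>2 f v\<close> vanishes
  there too; concretely, moving from \<open>v\<close> a little in direction \<open>- f v\<close> would make the form
  negative. Invariance of \<open>V\<close> keeps this direction inside \<open>V\<close>.
\<close>
lemma psd_null_vector:
  fixes f :: "'a::real_inner \<Rightarrow> 'a"
  assumes lin: "linear f" and sym: "\<And>x y. f x \<bullet> y = x \<bullet> f y"
    and V: "subspace V" and inv: "f ` V \<subseteq> V"
    and psd: "\<And>x. x \<in> V \<Longrightarrow> 0 \<le> x \<bullet> f x"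
    and v: "v \<in> V" "v \<bullet> f v = 0"
  shows "f v = 0"
proof (rule ccontr)
  assume nz: "f v \<noteq> 0"
  define w where "w = f v"
  define n where "n = w \<bullet> w"
  define c where "c = w \<bullet> f w"
  have n: "0 < n" using nz by (simp add: n_def w_def)
  have wV: "w \<in> V" using inv v by (auto simp: w_def)
  then have c: "0 \<le> c" using psd by (simp add: c_def)
  \<comment> \<open>The form at \<open>v - t w\<close> is \<open>t (t c - 2 n)\<close>; this step is short enough to give \<open>t c \<le> n\<close>, and
      the summand 1 keeps it defined for \<open>c = 0\<close>.\<close>
  define t where "t = n / (1 + c)"
  have t: "0 < t" using n c by (simp add: t_def)
  have "v - t *\<^sub>R w \<in> V" using V v wV by (simp add: subspace_diff subspace_scale)
  then have "0 \<le> (v - t *\<^sub>R w) \<bullet> f (v - t *\<^sub>R w)" by (rule psd)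
  also have "\<dots> = t * (t * c - 2 * n)"
    using v(2) sym[of v w]
    by (simp add: linear_diff[OF lin] linear_scale[OF lin] inner_diff_left inner_diff_right
        c_def n_def w_def[symmetric] algebra_simps)
  finally have "2 * n \<le> t * c" using t by (simp add: zero_le_mult_iff)
  also have "t * c \<le> n" using n c by (simp add: t_def field_simps)
  finally show False using n by simp
qed

text \<open>
  A maximiser \<open>v\<close> of the Rayleigh quotient over the unit sphere of \<open>V\<close> is an eigenvector for the
  maximum \<open>l\<close>: the operator \<open>l - f\<close> is positive semidefinite on \<open>V\<close> and its form vanishes at \<open>v\<close>.
\<close>
lemma eigenvector_in_invariant_subspace:
  fixes f :: "'a::euclidean_space \<Rightarrow> 'a"
  assumes lin: "linear f" and sym: "\<And>x y. f x \<bullet> y = x \<bullet> f y"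
    and V: "subspace V" and inv: "f ` V \<subseteq> V" and nontriv: "V \<noteq> {0}"
  obtains v l where "v \<in> V" "norm v = 1" "f v = l *\<^sub>R v"
proof -
  obtain x where x: "x \<in> V" "x \<noteq> 0" using nontriv subspace_0[OF V] by blast
  have "(1 / norm x) *\<^sub>R x \<in> V \<inter> sphere 0 1"
    using x V by (simp add: subspace_scale)
  then have ne: "V \<inter> sphere 0 1 \<noteq> {}" by blast
  have comp: "compact (V \<inter> sphere 0 1)"
    using closed_subspace[OF V] by (simp add: closed_Int_compact)
  have "continuous_on (V \<inter> sphere 0 1) (\<lambda>x. x \<bullet> f x)"
    using lin by (intro continuous_intros linear_continuous_on)
      (simp add: linear_conv_bounded_linear)
  from continuous_attains_sup[OF comp ne this] obtain v
    where v: "v \<in> V" "norm v = 1"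
      and max: "\<And>y. y \<in> V \<Longrightarrow> norm y = 1 \<Longrightarrow> y \<bullet> f y \<le> v \<bullet> f v"
    by auto
  define l where "l = v \<bullet> f v"
  define g where "g x = l *\<^sub>R x - f x" for x
  have "linear g" unfolding g_def using lin by (intro linear_compose_sub) auto
  moreover have "g x \<bullet> y = x \<bullet> g y" for x y
    by (simp add: g_def inner_diff_left inner_diff_right sym)
  moreover have "g ` V \<subseteq> V"
    using inv V by (auto simp: g_def intro!: subspace_diff subspace_scale)
  moreover have "0 \<le> x \<bullet> g x" if "x \<in> V" for x
  proof (cases "x = 0")
    case False
    define e where "e = (1 / norm x) *\<^sub>R x"
    have "e \<bullet> f e \<le> l" unfolding l_def
      by (rule max) (use that V False in \<open>auto simp: e_def subspace_scale\<close>)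
    then have "(x \<bullet> f x) / (norm x)\<^sup>2 \<le> l"
      by (simp add: e_def linear_scale[OF lin] power2_eq_square)
    then have "x \<bullet> f x \<le> l * (norm x)\<^sup>2" using False by (simp add: field_simps)
    then show ?thesis by (simp add: g_def inner_diff_right power2_norm_eq_inner)
  qed simp
  moreover have "v \<bullet> g v = 0"
    using v(2) by (simp add: g_def inner_diff_right l_def dot_square_norm)
  ultimately have "g v = 0" using psd_null_vector[of g V v] V v(1) by blast
  then have "f v = l *\<^sub>R v" by (simp add: g_def)
  with v show ?thesis by (rule that)
qed

text \<open>
  Split off one eigenvector; by symmetry its orthogonal complement in \<open>V\<close> is again invariant, and it
  has smaller dimension. The statement is relative to an invariant subspace for this induction.
\<close>
lemma orthonormal_eigenbasis:
  fixes f :: "'a::euclidean_space \<Rightarrow> 'a"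
  assumes lin: "linear f" and sym: "\<And>x y. f x \<bullet> y = x \<bullet> f y"
    and "subspace V" and "f ` V \<subseteq> V"
  shows "\<exists>B l. finite B \<and> B \<subseteq> V \<and> V \<subseteq> span B \<and> pairwise orthogonal B \<and>
           (\<forall>b\<in>B. norm b = 1 \<and> f b = l b *\<^sub>R b)"
  using assms(3,4)
proof (induction "dim V" arbitrary: V rule: less_induct)
  case less
  note V = less.prems(1) and inv = less.prems(2)
  show ?case
  proof (cases "V = {0}")
    case True
    then show ?thesis by (intro exI[of _ "{}"]) simp
  next
    case False
    obtain v l0 where v: "v \<in> V" "norm v = 1" "f v = l0 *\<^sub>R v"
      using eigenvector_in_invariant_subspace[OF lin sym V inv False] .
    define W where "W = {w \<in> V. v \<bullet> w = 0}"
    have vv: "v \<bullet> v = 1" using v(2) by (simp add: dot_square_norm)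
    have W: "subspace W"
      using V by (auto simp: W_def subspace_def inner_add_right)
    have Winv: "f ` W \<subseteq> W"
    proof
      fix y assume "y \<in> f ` W"
      then obtain w where w: "w \<in> V" "v \<bullet> w = 0" "y = f w" by (auto simp: W_def)
      have "v \<bullet> f w = l0 * (v \<bullet> w)" using sym[of v w] v(3) by simp
      then show "y \<in> W" using w inv by (auto simp: W_def)
    qed
    have "v \<notin> W" using vv by (simp add: W_def)
    moreover have "W \<subseteq> V" by (auto simp: W_def)
    ultimately have "span W \<subset> span V"
      using v(1) unfolding span_eq_iff[THEN iffD2, OF V] span_eq_iff[THEN iffD2, OF W] by blast
    then have "dim W < dim V" by (rule dim_psubset)
    from less.hyps[OF this W Winv] obtain B l
      where B: "finite B" "B \<subseteq> W" "W \<subseteq> span B" "pairwise orthogonal B"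
        and eig: "\<forall>b\<in>B. norm b = 1 \<and> f b = l b *\<^sub>R b"
      by blast
    have vB: "v \<notin> B" using B(2) vv by (auto simp: W_def)
    have "x \<in> span (insert v B)" if "x \<in> V" for x
    proof -
      have "x - (v \<bullet> x) *\<^sub>R v \<in> W"
        using that v(1) V vv by (auto simp: W_def subspace_diff subspace_scale inner_diff_right)
      then have "x - (v \<bullet> x) *\<^sub>R v \<in> span B" using B(3) by blast
      then show ?thesis by (auto simp: span_insert)
    qed
    moreover have "pairwise orthogonal (insert v B)"
      using B by (intro pairwise_orthogonal_insert) (auto simp: W_def orthogonal_def)
    moreover have "\<forall>b\<in>insert v B. norm b = 1 \<and> f b = (l(v := l0)) b *\<^sub>R b"
      using eig v vB by auto
    ultimately show ?thesis
      using B v(1) by (intro exI[of _ "insert v B"] exI[of _ "l(v := l0)"]) (auto simp: W_def)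
  qed
qed

section \<open>Square roots of positive semidefinite matrices\<close>

lemma symmetric_matrix_inner:
  fixes A :: "real^'n^'n"
  assumes "transpose A = A"
  shows "(A *v x) \<bullet> y = x \<bullet> (A *v y)"
  by (metis assms dot_lmul_matrix vector_transpose_matrix)

lemma symmetric_eigenbasis:
  fixes A :: "real^'n^'n"
  assumes "transpose A = A"
  obtains B l where "finite B" "span B = UNIV" "pairwise orthogonal B"
    "\<And>b. b \<in> B \<Longrightarrow> norm b = 1" "\<And>b. b \<in> B \<Longrightarrow> A *v b = l b *\<^sub>R b"
proof -
  obtain B l where "finite B" "UNIV \<subseteq> span B" "pairwise orthogonal B"
    "\<forall>b\<in>B. norm b = 1 \<and> A *v b = l b *\<^sub>R b"
    using orthonormal_eigenbasis[of "(*v) A" UNIV] symmetric_matrix_inner[OF assms] by auto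
  then show ?thesis by (intro that[of B l]) auto
qed

lemma matrix_eq_on_spanning_set:
  fixes A A' :: "real^'n^'m"
  assumes "span B = UNIV" and "\<And>b. b \<in> B \<Longrightarrow> A *v b = A' *v b"
  shows "A = A'"
  unfolding matrix_eq
  using linear_eq_on_span[of "(*v) A" "(*v) A'" B] assms by auto

text \<open>
  Keep the eigenvectors and replace each eigenvalue, which is nonnegative, by its square root.
\<close>
lemma sym_psd_sqrt_exists:
  fixes A :: "real^'n^'n"
  assumes "sym_psd A"
  shows "\<exists>S. sym_psd S \<and> S ** S = A"
proof -
  have sym: "transpose A = A" and psd: "\<And>v. 0 \<le> v \<bullet> (A *v v)"
    using assms by (auto simp: sym_psd_def)
  obtain B l where B: "finite B" "span B = UNIV" "pairwise orthogonal B"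
    and nrm: "\<And>b. b \<in> B \<Longrightarrow> norm b = 1" and eig: "\<And>b. b \<in> B \<Longrightarrow> A *v b = l b *\<^sub>R b"
    using symmetric_eigenbasis[OF sym] by metis
  have l: "0 \<le> l b" if "b \<in> B" for b
    using psd[of b] eig[OF that] nrm[OF that] by (simp add: dot_square_norm)
  define g where "g x = (\<Sum>b\<in>B. (sqrt (l b) * (b \<bullet> x)) *\<^sub>R b)" for x
  define S where "S = matrix g"
  have "linear g" unfolding g_def
    by (rule linearI)
      (simp_all add: inner_add_right distrib_left scaleR_add_left sum.distrib scaleR_sum_right
        mult.left_commute)
  then have S: "S *v x = g x" for x unfolding S_def by (simp add: matrix_works)
  have inner_g: "y \<bullet> g x = (\<Sum>b\<in>B. sqrt (l b) * (b \<bullet> x) * (b \<bullet> y))" for x y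
    by (simp add: g_def inner_sum_right inner_commute)
  have "transpose S = S"
  proof -
    have "(transpose S *v x) \<bullet> y = (S *v x) \<bullet> y" for x y
    proof -
      have "(transpose S *v x) \<bullet> y = x \<bullet> (S *v y)"
        by (metis dot_lmul_matrix vector_transpose_matrix transpose_transpose)
      also have "\<dots> = y \<bullet> (S *v x)" unfolding S inner_g by (simp add: mult_ac)
      finally show ?thesis by (simp add: inner_commute)
    qed
    then have "transpose S *v x = S *v x" for x by (metis vector_eq_rdot)
    then show ?thesis by (simp add: matrix_eq)
  qed
  moreover have "0 \<le> v \<bullet> (S *v v)" for v
    unfolding S inner_g by (rule sum_nonneg) (simp add: l mult.assoc)
  moreover have "S ** S = A"
  proof (rule matrix_eq_on_spanning_set[OF B(2)])
    fix b assume b: "b \<in> B"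
    have "b' \<bullet> b = (if b' = b then 1 else 0)" if "b' \<in> B" for b'
      using B(3) that b nrm[OF b] by (auto simp: pairwise_def orthogonal_def dot_square_norm)
    then have "g b = (\<Sum>b'\<in>B. if b' = b then sqrt (l b) *\<^sub>R b else 0)"
      unfolding g_def by (intro sum.cong) auto
    then have gb: "S *v b = sqrt (l b) *\<^sub>R b" using B(1) b by (simp add: S)
    then have "S *v (S *v b) = (sqrt (l b) * sqrt (l b)) *\<^sub>R b"
      by (simp add: matrix_vector_mult_scaleR)
    then show "(S ** S) *v b = A *v b" using l[OF b] eig[OF b]
      by (simp add: matrix_vector_mul_assoc[symmetric])
  qed
  ultimately show ?thesis by (auto simp: sym_psd_def)
qed

lemma sym_psd_null_vector:
  fixes A :: "real^'n^'n"
  assumes "sym_psd A" and "v \<bullet> (A *v v) = 0"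
  shows "A *v v = 0"
  using psd_null_vector[of "(*v) A" UNIV v] assms symmetric_matrix_inner[of A]
  by (auto simp: sym_psd_def)

text \<open>
  From \<open>S S = T T\<close> one gets \<open>\<langle>(S - T) b, (S + T) b\<rangle> = 0\<close> for every \<open>b\<close>. On an eigenvector \<open>b\<close> of
  \<open>S - T\<close> with nonzero eigenvalue this forces \<open>\<langle>b, S b\<rangle> + \<langle>b, T b\<rangle> = 0\<close>, hence \<open>S b = T b = 0\<close> by
  positivity. So \<open>S\<close> and \<open>T\<close> agree on an eigenbasis of their difference.
\<close>
lemma sym_psd_sqrt_unique:
  fixes S T :: "real^'n^'n"
  assumes S: "sym_psd S" and T: "sym_psd T" and eq: "S ** S = T ** T"
  shows "S = T"
proof -
  have tS: "transpose S = S" and tT: "transpose T = T"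
    using S T by (auto simp: sym_psd_def)
  have "transpose (S - T) = S - T"
    using tS tT by (simp add: transpose_def vec_eq_iff)
  from symmetric_eigenbasis[OF this] obtain B l
    where B: "span B = UNIV" and eig: "\<And>b. b \<in> B \<Longrightarrow> (S - T) *v b = l b *\<^sub>R b"
    by metis
  show ?thesis
  proof (rule matrix_eq_on_spanning_set[OF B])
    fix b assume b: "b \<in> B"
    have d: "S *v b - T *v b = l b *\<^sub>R b"
      using eig[OF b] by (simp add: matrix_vector_mult_diff_rdistrib)
    have "(S *v b) \<bullet> (S *v b) = b \<bullet> ((S ** S) *v b)"
      by (simp add: symmetric_matrix_inner[OF tS] matrix_vector_mul_assoc)
    also have "\<dots> = (T *v b) \<bullet> (T *v b)"
      by (simp add: symmetric_matrix_inner[OF tT] matrix_vector_mul_assoc eq)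
    finally have "(S *v b - T *v b) \<bullet> (S *v b + T *v b) = 0"
      by (simp add: inner_diff_left inner_add_right inner_commute[of "T *v b" "S *v b"])
    then have "l b * (b \<bullet> (S *v b) + b \<bullet> (T *v b)) = 0"
      by (simp add: d inner_add_right distrib_left)
    moreover have "0 \<le> b \<bullet> (S *v b)" "0 \<le> b \<bullet> (T *v b)"
      using S T by (auto simp: sym_psd_def)
    ultimately consider "l b = 0" | "b \<bullet> (S *v b) = 0" "b \<bullet> (T *v b) = 0"
      by fastforce
    then show "S *v b = T *v b"
    proof cases
      case 2
      then show ?thesis
        by (metis sym_psd_null_vector[OF S] sym_psd_null_vector[OF T])
    qed (use d in simp)
  qed
qed

lemma mat_sqrt:
  fixes A :: "real^'n^'n"
  assumes "sym_psd A"
  shows transpose_mat_sqrt: "transpose (mat_sqrt A) = mat_sqrt A"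
    and mat_sqrt_mul_self: "mat_sqrt A ** mat_sqrt A = A"
proof -
  have "\<exists>!S. sym_psd S \<and> S ** S = A"
    using sym_psd_sqrt_exists[OF assms] sym_psd_sqrt_unique by metis
  from theI'[OF this]
  have "sym_psd (mat_sqrt A) \<and> mat_sqrt A ** mat_sqrt A = A"
    unfolding mat_sqrt_def .
  then show "transpose (mat_sqrt A) = mat_sqrt A" "mat_sqrt A ** mat_sqrt A = A"
    by (auto simp: sym_psd_def)
qed

lemma matrix_inv_mult:
  fixes A :: "'a::semiring_1^'n^'m"
  assumes "invertible A"
  shows "A ** matrix_inv A = mat 1" "matrix_inv A ** A = mat 1"
  using someI_ex[OF assms[unfolded invertible_def]] by (auto simp: matrix_inv_def)

lemma mat_inv_sqrt:
  fixes A :: "real^'n^'n"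
  assumes "sym_psd A" and "invertible A"
  shows transpose_mat_inv_sqrt: "transpose (mat_inv_sqrt A) = mat_inv_sqrt A"
    and mat_sqrt_mul_inv_sqrt: "mat_sqrt A ** mat_inv_sqrt A = mat 1"
    and mat_inv_sqrt_mul_sqrt: "mat_inv_sqrt A ** mat_sqrt A = mat 1"
proof -
  let ?S = "mat_sqrt A" and ?N = "mat_inv_sqrt A"
  obtain A' where "A ** A' = mat 1" using assms(2) by (auto simp: invertible_def)
  then have "?S ** (?S ** A') = mat 1"
    by (simp add: matrix_mul_assoc mat_sqrt_mul_self[OF assms(1)])
  then have "invertible ?S" by (auto simp: invertible_right_inverse)
  then show SN: "?S ** ?N = mat 1" and NS: "?N ** ?S = mat 1"
    unfolding mat_inv_sqrt_def by (simp_all add: matrix_inv_mult)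
  have "transpose ?N ** ?S = mat 1"
    using SN transpose_mat_sqrt[OF assms(1)]
    by (metis matrix_transpose_mul transpose_mat)
  then have "transpose ?N = transpose ?N ** (?S ** ?N)" by (simp add: SN)
  also have "\<dots> = (transpose ?N ** ?S) ** ?N" by (simp add: matrix_mul_assoc)
  also have "\<dots> = ?N" by (simp add: \<open>transpose ?N ** ?S = mat 1\<close>)
  finally show "transpose ?N = ?N" .
qed

section \<open>Block vectors and block matrices\<close>

lemma vstack_nth [simp]: "vstack v w $ Inl i = v $ i" "vstack v w $ Inr j = w $ j"
  by (simp_all add: vstack_def)

lemma vec_eq_sum_iff:
  "(x :: 'a^('m::finite + 'n::finite)) = y \<longleftrightarrow>
     (\<forall>i. x $ Inl i = y $ Inl i) \<and> (\<forall>j. x $ Inr j = y $ Inr j)"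
  unfolding vec_eq_iff by (metis sum.exhaust)

lemma vstack_eq_iff: "vstack v w = vstack v' w' \<longleftrightarrow> v = v' \<and> w = w'"
  by (auto simp: vec_eq_sum_iff) (auto simp: vec_eq_iff)

lemma vstack_surj:
  obtains v w where "x = vstack v w"
  by (rule that[of "\<chi> i. x $ Inl i" "\<chi> j. x $ Inr j"]) (simp add: vec_eq_sum_iff)

lemma vstack_add: "vstack v w + vstack v' w' = vstack (v + v') (w + w')"
  by (simp add: vec_eq_sum_iff)

lemma sum_UNIV_Plus:
  fixes g :: "'m::finite + 'n::finite \<Rightarrow> 'a::comm_monoid_add"
  shows "sum g UNIV = (\<Sum>i\<in>UNIV. g (Inl i)) + (\<Sum>j\<in>UNIV. g (Inr j))"
  unfolding UNIV_Plus_UNIV[symmetric] by (subst sum.Plus) auto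

lemma inner_vstack:
  fixes v v' :: "real^'m" and w w' :: "real^'n"
  shows "vstack v w \<bullet> vstack v' w' = v \<bullet> v' + w \<bullet> w'"
  by (simp add: inner_vec_def sum_UNIV_Plus)

lemma vstack_mult_vec: "vstack A B *v x = vstack (A *v x) (B *v x)"
  by (simp add: vec_eq_sum_iff matrix_vector_mult_def)

lemma hstack_mult_vstack: "hstack A B *v vstack v w = A *v v + B *v w"
  by (simp add: vec_eq_iff matrix_vector_mult_def hstack_def sum_UNIV_Plus)

lemma has_vector_derivative_vstack_iff:
  fixes v :: "real \<Rightarrow> real^'m" and w :: "real \<Rightarrow> real^'n"
  shows "((\<lambda>t. vstack (v t) (w t)) has_vector_derivative vstack v' w') F \<longleftrightarrow>
         (v has_vector_derivative v') F \<and> (w has_vector_derivative w') F"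
    (is "?vw \<longleftrightarrow> ?v \<and> ?w")
proof
  have l: "bounded_linear (\<lambda>x::real^('m+'n). \<chi> i. x $ Inl i)"
    and r: "bounded_linear (\<lambda>x::real^('m+'n). \<chi> j. x $ Inr j)"
    by (auto simp: linear_conv_bounded_linear[symmetric] linear_iff vec_eq_iff)
  assume ?vw
  from bounded_linear.has_vector_derivative[OF l this]
    bounded_linear.has_vector_derivative[OF r this]
  show "?v \<and> ?w" by simp
next
  have l: "bounded_linear (\<lambda>x. vstack x (0::real^'n) :: real^('m+'n))"
    and r: "bounded_linear (\<lambda>x. vstack (0::real^'m) x :: real^('m+'n))"
    by (auto simp: linear_conv_bounded_linear[symmetric] linear_iff vec_eq_sum_iff)
  assume vw: "?v \<and> ?w"
  have "((\<lambda>t. vstack (v t) 0 + vstack 0 (w t)) has_vector_derivative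
      vstack v' 0 + vstack 0 w') F"
    using vw by (intro has_vector_derivative_add bounded_linear.has_vector_derivative[OF l]
        bounded_linear.has_vector_derivative[OF r]) auto
  then show ?vw by (simp add: vstack_add)
qed

lemma C1_on_lower_block:
  fixes v :: "real \<Rightarrow> real^'m" and w :: "real \<Rightarrow> real^'n"
  assumes "C1_on T (\<lambda>t. vstack (v t) (w t))"
  shows "C1_on T w"
proof -
  obtain f' where f': "\<forall>t\<in>T. ((\<lambda>t. vstack (v t) (w t)) has_vector_derivative f' t) (at t within T)"
    "continuous_on T f'"
    using assms by (auto simp: C1_on_def)
  define p where "p t = (\<chi> i. f' t $ Inl i)" for t
  define q where "q t = (\<chi> j. f' t $ Inr j)" for t
  have "f' t = vstack (p t) (q t)" for t by (simp add: vec_eq_sum_iff p_def q_def)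
  then have "\<forall>t\<in>T. (w has_vector_derivative q t) (at t within T)"
    using f'(1) by (simp add: has_vector_derivative_vstack_iff)
  moreover have "continuous_on T q"
    unfolding q_def using f'(2) by (auto intro!: continuous_on_vec_lambda continuous_on_component)
  ultimately show ?thesis by (auto simp: C1_on_def)
qed

section \<open>One-sided calculus on the half-line\<close>

lemma deriv_on_eqI:
  assumes "(f has_vector_derivative f') (at t within {0..})" and "0 \<le> t"
  shows "deriv_on {0..} f t = f'"
proof -
  have "t islimpt {t<..<t + 1}" by (rule islimpt_greaterThanLessThan1) simp
  then have "t islimpt {0..}" by (rule islimpt_subset) (use assms(2) in auto)
  then have "at t within {0..} \<noteq> bot" by (simp add: trivial_limit_within)
  then show ?thesis unfolding deriv_on_def using assms(1) by (rule vector_derivative_within)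
qed

text \<open>
  Differentiability within the half-line is local: near \<open>t\<close> it coincides with the compact
  interval \<open>[0, t + 1]\<close>, where the fundamental theorem of calculus applies.
\<close>
lemma has_vector_derivative_integral_halfline:
  fixes f :: "real \<Rightarrow> 'a::banach"
  assumes "continuous_on {0..} f" and "0 \<le> t"
  shows "((\<lambda>t. integral {0..t} f) has_vector_derivative f t) (at t within {0..})"
proof -
  have "continuous_on {0..t + 1} f" using assms(1) by (rule continuous_on_subset) auto
  then have "((\<lambda>t. integral {0..t} f) has_vector_derivative f t) (at t within {0..t + 1})"
    by (rule integral_has_vector_derivative) (use assms(2) in auto)
  also have "at t within {0..t + 1} = at t within {0..}"
    by (rule at_within_nhd[where S = "{t - 1<..<t + 1}"]) auto
  finally show ?thesis .
qed

lemma has_vector_derivative_matrix_vector_mult: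
  fixes A :: "real^'n^'m"
  assumes "(f has_vector_derivative f') F"
  shows "((\<lambda>t. A *v f t) has_vector_derivative A *v f') F"
  using bounded_linear.has_vector_derivative[OF matrix_vector_mul_bounded_linear assms] .

lemma C1_on_imp_continuous_on: "C1_on T f \<Longrightarrow> continuous_on T f"
  by (auto simp: C1_on_def continuous_on_eq_continuous_within
      intro: has_vector_derivative_continuous)

section \<open>The second-order equation as a passive first-order system\<close>

lemma sys_A_mult_vstack:
  "sys_A M P K *v vstack v w =
     vstack (mat_sqrt K *v (mat_inv_sqrt M *v w))
       (- (mat_inv_sqrt M *v (mat_sqrt K *v v + P *v (mat_inv_sqrt M *v w))))"
proof -
  have neg: "(- A) *v x = - (A *v x)" for A :: "real^'n^'m" and x
    by (simp add: vec_eq_iff matrix_vector_mult_def sum_negf)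
  show ?thesis
    by (simp add: sys_A_def vstack_mult_vec hstack_mult_vstack neg matrix_vector_mul_assoc[symmetric]
        matrix_vector_right_distrib)
qed

lemma sys_B_mult: "sys_B M F *v u = vstack 0 (mat_inv_sqrt M *v (F *v u))"
  by (simp add: sys_B_def vstack_mult_vec matrix_vector_mul_assoc)

lemma sys_C_mult_vstack: "sys_C M F *v vstack v w = transpose F *v (mat_inv_sqrt M *v w)"
  by (simp add: sys_C_def hstack_mult_vstack matrix_vector_mul_assoc)

text \<open>
  The coupling terms \<open>\<langle>x\<^sub>1, R N x\<^sub>2\<rangle>\<close> and \<open>\<langle>x\<^sub>2, N R x\<^sub>1\<rangle>\<close> enter with opposite signs and cancel, so the
  stored energy can grow only through the input.
\<close>
lemma sys_impedance_passive:
  fixes M P K :: "real^'m^'m" and F :: "real^'k^'m"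
  assumes M: "sym_psd M" "invertible M" and P: "sym_psd P" and K: "sym_psd K"
  shows "impedance_passive T (sys_A M P K) (sys_B M F) (sys_C M F) 0"
  unfolding impedance_passive_def
proof (intro allI impI ballI)
  fix u x y t
  assume sys: "linear_system T (sys_A M P K) (sys_B M F) (sys_C M F) 0 u x y" and t: "t \<in> T"
  define x' where "x' = sys_A M P K *v x t + sys_B M F *v u t"
  have x': "(x has_vector_derivative x') (at t within T)" and y: "y t = sys_C M F *v x t"
    using sys t by (simp_all add: linear_system_def x'_def)
  have "((\<lambda>s. x s \<bullet> x s) has_derivative (\<lambda>h. x t \<bullet> (h *\<^sub>R x') + (h *\<^sub>R x') \<bullet> x t)) (at t within T)"
    using x' unfolding has_vector_derivative_def by (intro has_derivative_inner)
  then have "((\<lambda>s. (norm (x s))\<^sup>2) has_real_derivative 2 * (x t \<bullet> x')) (at t within T)"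
    unfolding has_field_derivative_def power2_norm_eq_inner
    by (rule has_derivative_eq_rhs) (auto simp: fun_eq_iff inner_commute)
  moreover have "x t \<bullet> x' \<le> u t \<bullet> y t"
  proof -
    obtain v w where vw: "x t = vstack v w" by (rule vstack_surj)
    define N where "N = mat_inv_sqrt M"
    define R where "R = mat_sqrt K"
    have N: "(N *v a) \<bullet> b = a \<bullet> (N *v b)" for a b
      unfolding N_def by (rule symmetric_matrix_inner[OF transpose_mat_inv_sqrt[OF M]])
    have R: "(R *v a) \<bullet> b = a \<bullet> (R *v b)" for a b
      unfolding R_def by (rule symmetric_matrix_inner[OF transpose_mat_sqrt[OF K]])
    have F: "a \<bullet> (transpose F *v b) = (F *v a) \<bullet> b" for a b
      by (metis dot_lmul_matrix vector_transpose_matrix transpose_transpose)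
    have "x t \<bullet> x' = v \<bullet> (R *v (N *v w)) - w \<bullet> (N *v (R *v v))
        - w \<bullet> (N *v (P *v (N *v w))) + w \<bullet> (N *v (F *v u t))"
      by (simp add: x'_def vw sys_A_mult_vstack sys_B_mult vstack_add inner_vstack
          N_def[symmetric] R_def[symmetric] inner_add_right inner_diff_right
          matrix_vector_right_distrib)
    also have "w \<bullet> (N *v (R *v v)) = v \<bullet> (R *v (N *v w))"
      by (metis N R inner_commute)
    also have "w \<bullet> (N *v (P *v (N *v w))) = (N *v w) \<bullet> (P *v (N *v w))" by (simp add: N)
    also have "w \<bullet> (N *v (F *v u t)) = u t \<bullet> y t"
      unfolding y vw sys_C_mult_vstack N_def[symmetric] F by (metis N inner_commute)
    finally show ?thesis using P by (simp add: sym_psd_def)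
  qed
  ultimately show "\<exists>d. ((\<lambda>s. (norm (x s))\<^sup>2) has_real_derivative d) (at t within T) \<and>
      d \<le> 2 * (u t \<bullet> y t)"
    by auto
qed

lemma position_has_vector_derivative:
  assumes "continuous_on {0..} w" and "0 \<le> t"
  shows "(position M w \<gamma> has_vector_derivative mat_inv_sqrt M *v w t) (at t within {0..})"
proof -
  have "continuous_on {0..} (\<lambda>\<tau>. mat_inv_sqrt M *v w \<tau>)"
    using assms(1) by (intro bounded_linear.continuous_on[OF matrix_vector_mul_bounded_linear])
  from has_vector_derivative_add_const[THEN iffD2, OF has_vector_derivative_integral_halfline[OF this assms(2)]]
  show ?thesis unfolding position_def .
qed

lemma position_0: "position M w \<gamma> 0 = \<gamma>"
  by (simp add: position_def)

lemma position_velocity: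
  assumes "continuous_on {0..} w" and "0 \<le> t"
  shows "deriv_on {0..} (position M w \<gamma>) t = mat_inv_sqrt M *v w t"
  using position_has_vector_derivative[OF assms] assms(2) by (rule deriv_on_eqI)

lemma position_acceleration:
  assumes w: "continuous_on {0..} w" and t: "0 \<le> t"
    and w': "(w has_vector_derivative w') (at t within {0..})"
  shows "deriv_on {0..} (deriv_on {0..} (position M w \<gamma>)) t = mat_inv_sqrt M *v w'"
proof (rule deriv_on_eqI[OF _ t])
  show "(deriv_on {0..} (position M w \<gamma>) has_vector_derivative mat_inv_sqrt M *v w')
      (at t within {0..})"
    by (rule has_vector_derivative_transform[OF _ _ has_vector_derivative_matrix_vector_mult[OF w']])
      (use t in \<open>auto simp: position_velocity[OF w]\<close>)
qed

lemma C2_on_position: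
  assumes "C1_on {0..} w"
  shows "C2_on {0..} (position M w \<gamma>)"
proof -
  obtain w' where w': "\<forall>t\<in>{0..}. (w has_vector_derivative w' t) (at t within {0..})"
    "continuous_on {0..} w'"
    using assms by (auto simp: C1_on_def)
  then have "C1_on {0..} (\<lambda>t. mat_inv_sqrt M *v w t)"
    unfolding C1_on_def
    by (intro exI[of _ "\<lambda>t. mat_inv_sqrt M *v w' t"])
      (auto intro: has_vector_derivative_matrix_vector_mult
        bounded_linear.continuous_on[OF matrix_vector_mul_bounded_linear])
  then show ?thesis
    unfolding C2_on_def
    by (intro exI[of _ "\<lambda>t. mat_inv_sqrt M *v w t"])
      (use position_has_vector_derivative[OF C1_on_imp_continuous_on[OF assms]]
       in auto)
qed

text \<open>
  Under \<open>x\<^sub>1 = R z\<close> (here \<open>v\<close> stands for \<open>x\<^sub>1\<close> and \<open>w\<close> for \<open>x\<^sub>2\<close>) the elastic force is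
  \<open>K z = R x\<^sub>1\<close> and the inertial force is \<open>M N x\<^sub>2' = M\<^sup>1\<^sup>/\<^sup>2 x\<^sub>2'\<close>. Multiplying the second-order equation by
  the invertible matrix \<open>N\<close> therefore yields exactly the second block row of the first-order system.
\<close>
lemma second_order_iff_momentum_balance:
  fixes M P K :: "real^'m^'m" and F :: "real^'k^'m"
  assumes M: "sym_psd M" "invertible M" and K: "sym_psd K"
    and w: "\<And>t. 0 \<le> t \<Longrightarrow> (w has_vector_derivative w' t) (at t within {0..})"
    and v: "\<And>t. 0 \<le> t \<Longrightarrow> v t = mat_sqrt K *v position M w \<gamma> t"
  shows "second_order_system M P K F u (position M w \<gamma>) y \<longleftrightarrow>
    (\<forall>t\<ge>0. w' t = - (mat_inv_sqrt M *v (mat_sqrt K *v v t + P *v (mat_inv_sqrt M *v w t)))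
                  + mat_inv_sqrt M *v (F *v u t) \<and>
            y t = transpose F *v (mat_inv_sqrt M *v w t))"
proof -
  define N where "N = mat_inv_sqrt M"
  define S where "S = mat_sqrt M"
  have SN: "S *v (N *v a) = a" and NS: "N *v (S *v a) = a" and SS: "S *v (S *v a) = M *v a" for a
    unfolding N_def S_def
    by (simp_all add: matrix_vector_mul_assoc mat_sqrt_mul_inv_sqrt[OF M] mat_inv_sqrt_mul_sqrt[OF M]
        mat_sqrt_mul_self[OF M(1)])
  have RR: "mat_sqrt K *v (mat_sqrt K *v a) = K *v a" for a
    by (simp add: matrix_vector_mul_assoc mat_sqrt_mul_self[OF K])
  have wc: "continuous_on {0..} w"
    using w by (auto simp: continuous_on_eq_continuous_within intro: has_vector_derivative_continuous)
  have "M *v (N *v w' t) + P *v (N *v w t) + K *v position M w \<gamma> t = F *v u t \<longleftrightarrow>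
      w' t = - (N *v (mat_sqrt K *v v t + P *v (N *v w t))) + N *v (F *v u t)" if "0 \<le> t" for t
  proof -
    define c where "c = mat_sqrt K *v v t + P *v (N *v w t)"
    have "M *v (N *v w' t) + P *v (N *v w t) + K *v position M w \<gamma> t = F *v u t \<longleftrightarrow>
        S *v w' t + c = F *v u t"
      by (simp add: SS[symmetric] SN c_def v[OF that] RR add_ac)
    also have "\<dots> \<longleftrightarrow> N *v (S *v w' t + c) = N *v (F *v u t)"
      by (metis SN)
    also have "\<dots> \<longleftrightarrow> w' t = - (N *v c) + N *v (F *v u t)"
      by (auto simp: matrix_vector_right_distrib NS algebra_simps)
    finally show ?thesis unfolding c_def .
  qed
  then show ?thesis
    unfolding second_order_system_def
    by (auto simp: position_velocity[OF wc] position_acceleration[OF wc _ w] N_def)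
qed

text \<open>
  The initial value \<open>x\<^sub>1(0) = \<alpha>\<close> is absorbed by the identity \<open>x\<^sub>1 = R z\<close> at time 0, because
  \<open>z(0) = \<gamma>\<close> and \<open>R \<gamma> = \<alpha>\<close>; the initial velocity determines \<open>x\<^sub>2(0)\<close> because \<open>N\<close> is injective.
\<close>
lemma first_order_iff_second_order:
  fixes M P K :: "real^'m^'m" and F :: "real^'k^'m"
  assumes M: "sym_psd M" "invertible M" and K: "sym_psd K"
    and w: "C1_on {0..} w" and \<gamma>: "mat_sqrt K *v \<gamma> = \<alpha>"
  shows "linear_system {0..} (sys_A M P K) (sys_B M F) (sys_C M F) 0 u
           (\<lambda>t. vstack (v t) (w t)) y \<and> vstack (v 0) (w 0) = vstack \<alpha> \<beta> \<longleftrightarrow>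
         (\<forall>t\<ge>0. v t = mat_sqrt K *v position M w \<gamma> t) \<and>
         second_order_system M P K F u (position M w \<gamma>) y \<and>
         position M w \<gamma> 0 = \<gamma> \<and>
         deriv_on {0..} (position M w \<gamma>) 0 = mat_inv_sqrt M *v \<beta>"
    (is "?first \<longleftrightarrow> ?second")
proof -
  let ?N = "mat_inv_sqrt M" and ?R = "mat_sqrt K" and ?z = "position M w \<gamma>"
  obtain w' where w': "\<And>t. 0 \<le> t \<Longrightarrow> (w has_vector_derivative w' t) (at t within {0..})"
    using w by (auto simp: C1_on_def)
  note wc = C1_on_imp_continuous_on[OF w]
  have Rz: "((\<lambda>t. ?R *v ?z t) has_vector_derivative ?R *v (?N *v w t)) (at t within {0..})"
    if "0 \<le> t" for t
    by (rule has_vector_derivative_matrix_vector_mult[OF position_has_vector_derivative[OF wc that]])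
  have "mat_sqrt M *v (?N *v a) = a" for a
    by (simp add: matrix_vector_mul_assoc mat_sqrt_mul_inv_sqrt[OF M])
  then have inj: "?N *v a = ?N *v b \<longleftrightarrow> a = b" for a b by metis
  define accel where "accel t = - (?N *v (?R *v v t + P *v (?N *v w t))) + ?N *v (F *v u t)" for t
  have w_accel: "(w has_vector_derivative a) (at t within {0..}) \<longleftrightarrow> w' t = a" if "0 \<le> t" for t a
    using w'[OF that] that deriv_on_eqI by metis
  have "?first \<longleftrightarrow>
      (\<forall>t\<ge>0. (v has_vector_derivative ?R *v (?N *v w t)) (at t within {0..}) \<and>
              w' t = accel t \<and> y t = transpose F *v (?N *v w t)) \<and> v 0 = \<alpha> \<and> w 0 = \<beta>"
    by (auto simp: linear_system_def sys_A_mult_vstack sys_B_mult sys_C_mult_vstack vstack_add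
        has_vector_derivative_vstack_iff vstack_eq_iff w_accel accel_def)
  \<comment> \<open>The first block row and \<open>v 0 = \<alpha>\<close> together integrate to \<open>v = R z\<close>.\<close>
  also have "\<dots> \<longleftrightarrow> (\<forall>t\<ge>0. v t = ?R *v ?z t) \<and>
      (\<forall>t\<ge>0. w' t = accel t \<and> y t = transpose F *v (?N *v w t)) \<and> w 0 = \<beta>"
  proof -
    have "(\<forall>t\<ge>0. (v has_vector_derivative ?R *v (?N *v w t)) (at t within {0..})) \<and> v 0 = \<alpha>
        \<longleftrightarrow> (\<forall>t\<ge>0. v t = ?R *v ?z t)"
    proof safe
      fix t :: real
      assume t: "0 \<le> t" and v0: "\<alpha> = v 0"
        and v: "\<forall>t\<ge>0. (v has_vector_derivative ?R *v (?N *v w t)) (at t within {0..})"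
      have "((\<lambda>t. v t - ?R *v ?z t) has_vector_derivative 0) (at s within {0..})"
        if "s \<in> {0..}" for s
        using has_vector_derivative_diff[OF v[rule_format, of s] Rz[of s]] that by simp
      then obtain c where c: "\<And>s. s \<in> {0..} \<Longrightarrow> v s - ?R *v ?z s = c"
        using has_vector_derivative_zero_constant[OF convex_real_interval(1)] by blast
      have "c = 0" using c[of 0] \<gamma> v0 by (simp add: position_0)
      then show "v t = ?R *v ?z t" using c[of t] t by simp
    next
      fix t :: real
      assume v: "\<forall>t\<ge>0. v t = ?R *v ?z t" and t: "0 \<le> t"
      show "(v has_vector_derivative ?R *v (?N *v w t)) (at t within {0..})"
        by (rule has_vector_derivative_transform[OF _ _ Rz[OF t]]) (use v t in auto)
    next
      assume "\<forall>t\<ge>0. v t = ?R *v ?z t"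
      then show "v 0 = \<alpha>" using \<gamma> by (simp add: position_0)
    qed
    then show ?thesis by meson
  qed
  also have "\<dots> \<longleftrightarrow> (\<forall>t\<ge>0. v t = ?R *v ?z t) \<and> second_order_system M P K F u ?z y \<and> w 0 = \<beta>"
    using second_order_iff_momentum_balance[OF M K w', of v \<gamma> P F u y]
    unfolding accel_def by blast
  also have "\<dots> \<longleftrightarrow> ?second"
    using position_0 position_velocity[OF wc, of 0 M \<gamma>] inj by auto
  finally show ?thesis .
qed

theorem corollary3:
  fixes M P K :: "real^'m^'m" and F :: "real^'k^'m" and u :: "real \<Rightarrow> real^'k"
  assumes "sym_psd M" and "sym_psd P" and "sym_psd K" and "invertible M"
    and "continuous_on {0..} u"
  shows "impedance_passive {0..} (sys_A M P K) (sys_B M F) (sys_C M F) 0 \<and>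
    (\<forall>\<alpha> \<in> range (\<lambda>v. K *v v). \<forall>\<beta> x1 x2 y. C1_on {0..} (\<lambda>t. vstack (x1 t) (x2 t)) \<longrightarrow>
       (let x = (\<lambda>t. vstack (x1 t) (x2 t));
            first_order = (linear_system {0..} (sys_A M P K) (sys_B M F) (sys_C M F) 0 u x y \<and>
                           x 0 = vstack \<alpha> \<beta>);
            z = position M x2;
            second_order = (\<lambda>\<gamma>. (\<forall>t\<ge>0. x1 t = mat_sqrt K *v z \<gamma> t) \<and>
                                second_order_system M P K F u (z \<gamma>) y \<and>
                                z \<gamma> 0 = \<gamma> \<and>
                                deriv_on {0..} (z \<gamma>) 0 = mat_inv_sqrt M *v \<beta>)
        in (\<forall>\<gamma>. C2_on {0..} (z \<gamma>)) \<and>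
           (first_order \<longleftrightarrow> (\<exists>\<gamma>. mat_sqrt K *v \<gamma> = \<alpha> \<and> second_order \<gamma>)) \<and>
           (first_order \<longleftrightarrow> (\<forall>\<gamma>. mat_sqrt K *v \<gamma> = \<alpha> \<longrightarrow> second_order \<gamma>))))"
proof (intro conjI ballI allI impI)
  show "impedance_passive {0..} (sys_A M P K) (sys_B M F) (sys_C M F) 0"
    using assms by (intro sys_impedance_passive)
next
  fix \<alpha> \<beta> :: "real^'m" and x1 x2 :: "real \<Rightarrow> real^'m" and y
  assume "\<alpha> \<in> range (\<lambda>v. K *v v)" and C1: "C1_on {0..} (\<lambda>t. vstack (x1 t) (x2 t))"
  then obtain \<delta> where "\<alpha> = K *v \<delta>" by blast
  then have "mat_sqrt K *v (mat_sqrt K *v \<delta>) = \<alpha>"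
    by (simp add: matrix_vector_mul_assoc mat_sqrt_mul_self[OF assms(3)])
  then have ex: "\<exists>\<gamma>. mat_sqrt K *v \<gamma> = \<alpha>" by blast
  note x2 = C1_on_lower_block[OF C1]
  let ?first = "linear_system {0..} (sys_A M P K) (sys_B M F) (sys_C M F) 0 u
      (\<lambda>t. vstack (x1 t) (x2 t)) y \<and> vstack (x1 0) (x2 0) = vstack \<alpha> \<beta>"
  let ?second = "\<lambda>\<gamma>. (\<forall>t\<ge>0. x1 t = mat_sqrt K *v position M x2 \<gamma> t) \<and>
      second_order_system M P K F u (position M x2 \<gamma>) y \<and> position M x2 \<gamma> 0 = \<gamma> \<and>
      deriv_on {0..} (position M x2 \<gamma>) 0 = mat_inv_sqrt M *v \<beta>"
  have equiv: "?first \<longleftrightarrow> ?second \<gamma>" if "mat_sqrt K *v \<gamma> = \<alpha>" for \<gamma>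
    by (rule first_order_iff_second_order[OF assms(1,4,3) x2 that])
  have some_all: "Q \<longleftrightarrow> (\<exists>\<gamma>. P \<gamma> \<and> R \<gamma>)" "Q \<longleftrightarrow> (\<forall>\<gamma>. P \<gamma> \<longrightarrow> R \<gamma>)"
    if "\<exists>\<gamma>. P \<gamma>" "\<And>\<gamma>. P \<gamma> \<Longrightarrow> Q \<longleftrightarrow> R \<gamma>" for P R :: "real^'m \<Rightarrow> bool" and Q
    using that by blast+
  show "let x = (\<lambda>t. vstack (x1 t) (x2 t));
            first_order = (linear_system {0..} (sys_A M P K) (sys_B M F) (sys_C M F) 0 u x y \<and>
                           x 0 = vstack \<alpha> \<beta>);
            z = position M x2;
            second_order = (\<lambda>\<gamma>. (\<forall>t\<ge>0. x1 t = mat_sqrt K *v z \<gamma> t) \<and>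
                                second_order_system M P K F u (z \<gamma>) y \<and>
                                z \<gamma> 0 = \<gamma> \<and>
                                deriv_on {0..} (z \<gamma>) 0 = mat_inv_sqrt M *v \<beta>)
        in (\<forall>\<gamma>. C2_on {0..} (z \<gamma>)) \<and>
           (first_order \<longleftrightarrow> (\<exists>\<gamma>. mat_sqrt K *v \<gamma> = \<alpha> \<and> second_order \<gamma>)) \<and>
           (first_order \<longleftrightarrow> (\<forall>\<gamma>. mat_sqrt K *v \<gamma> = \<alpha> \<longrightarrow> second_order \<gamma>))"
    unfolding Let_def
  proof (intro conjI allI)
    show "C2_on {0..} (position M x2 \<gamma>)" for \<gamma> by (rule C2_on_position[OF x2])
  next
    show "?first \<longleftrightarrow> (\<exists>\<gamma>. mat_sqrt K *v \<gamma> = \<alpha> \<and> ?second \<gamma>)"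
      by (rule some_all(1)[where Q = ?first and R = ?second, OF ex equiv])
  next
    show "?first \<longleftrightarrow> (\<forall>\<gamma>. mat_sqrt K *v \<gamma> = \<alpha> \<longrightarrow> ?second \<gamma>)"
      by (rule some_all(2)[where Q = ?first and R = ?second, OF ex equiv])
  qed
qed

end
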